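(* Let $(X,d,\nu)$ be a metric measure space with doubling measure $\nu$ and supporting a $1$-Poincaré inequality. Given $u\in L^1(X,\nu)$, we have that $u\in BV(X,d,\nu)$ if, and only if, $$\liminf_{\epsilon\to0^+}\frac1\epsilon TV_{m^{\nu,\epsilon}}(u)<\infty.$$ Moreover, there is a constant $C\ge1$, depending only on $(X,d,\nu)$, such that, for every $u\in BV(X,d,\nu)$, $$\frac1C|Du|_\nu(X)\le\liminf_{\epsilon\to0^+}\frac1\epsilon TV_{m^{\nu,\epsilon}}(u)\le C\,|Du|_\nu(X).$$
   Context: $(X,d)$ is a Polish metric space with a Borel (Radon) measure $\nu$; $B(x,r)$ is the open ball. $\nu$ is doubling if there is $C_D\ge1$ with $0<\nu(B(x,2r))\le C_D\,\nu(B(x,r))<\infty$ for all $x\in X$, $r>0$. For $u:X\to\mathbb R$ the slope is $|\nabla u|(x)=\limsup_{y\to x}\frac{|u(y)-u(x)|}{d(x,y)}$ (equal to $0$ at isolated points). $(X,d,\nu)$ supports a $1$-Poincaré inequality if there are $c>0$, $\lambda\ge1$ such that for every Lipschitz $u:X\to\mathbb R$ and every ball $B(x,r)$, $$\int_{B(x,r)}|u(y)-u_{B(x,r)}|\,d\nu(y)\le c\,r\int_{B(x,\lambda r)}|\nabla u|(y)\,d\nu(y),\qquad u_{B(x,r)}=\frac1{\nu(B(x,r))}\int_{B(x,r)}u\,d\nu.$$ $u\in L^1(X,\nu)$ belongs to $BV(X,d,\nu)$ if there is a sequence $(u_n)$ of locally Lipschitz functions converging to $u$ in $L^1(X,\nu)$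 with $\sup_n\int_X|\nabla u_n|\,d\nu<\infty$. For such $u$, $$|Du|_\nu(X)=\inf\left\{\liminf_{n\to\infty}\int_X|\nabla u_n|\,d\nu:\ u_n \text{ locally Lipschitz},\ u_n\to u \text{ in } L^1(X,\nu)\right\}.$$ The $\epsilon$-step random walk associated to $\nu$ is $m^{\nu,\epsilon}_x=\frac{\nu\lfloor B(x,\epsilon)}{\nu(B(x,\epsilon))}$ (normalized restriction of $\nu$ to the ball), and $$TV_{m^{\nu,\epsilon}}(u)=\frac12\int_X\frac1{\nu(B(x,\epsilon))}\int_{B(x,\epsilon)}|u(y)-u(x)|\,d\nu(y)\,d\nu(x).$$ *)

theory Defs
  imports "HOL-Analysis.Analysis"
begin

definition doubling :: "'a::metric_space measure \<Rightarrow> bool" where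
  "doubling \<nu> \<longleftrightarrow> (\<exists>C\<^sub>D\<ge>1::real. \<forall>x. \<forall>r>0.
     0 < emeasure \<nu> (ball x (2 * r)) \<and>
     emeasure \<nu> (ball x (2 * r)) \<le> ennreal C\<^sub>D * emeasure \<nu> (ball x r) \<and>
     ennreal C\<^sub>D * emeasure \<nu> (ball x r) < \<infinity>)"

(* At an isolated point the filter "at x" is trivial, and the Limsup of an ennreal-valued
   function along the trivial filter is 0, as the definition of the slope requires. *)
definition slope :: "('a::metric_space \<Rightarrow> real) \<Rightarrow> 'a \<Rightarrow> ennreal" where
  "slope u x = Limsup (at x) (\<lambda>y. ennreal (\<bar>u y - u x\<bar> / dist x y))"

lemma slope_isolated: "at x = bot \<Longrightarrow> slope u x = 0"
  by (simp add: slope_def bot_ennreal)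

definition ball_avg :: "'a::metric_space measure \<Rightarrow> ('a \<Rightarrow> real) \<Rightarrow> 'a \<Rightarrow> real \<Rightarrow> real" where
  "ball_avg \<nu> u x r = 1 / measure \<nu> (ball x r) * (LINT y:ball x r|\<nu>. u y)"

definition supports_poincare_1 :: "'a::metric_space measure \<Rightarrow> bool" where
  "supports_poincare_1 \<nu> \<longleftrightarrow> (\<exists>c>0::real. \<exists>\<Lambda>\<ge>1::real.
     \<forall>u :: 'a \<Rightarrow> real. (\<exists>L. L-lipschitz_on UNIV u) \<longrightarrow> (\<forall>x. \<forall>r>0.
       (\<integral>\<^sup>+y\<in>ball x r. ennreal \<bar>u y - ball_avg \<nu> u x r\<bar> \<partial>\<nu>)
         \<le> ennreal (c * r) * (\<integral>\<^sup>+y\<in>ball x (\<Lambda> * r). slope u y \<partial>\<nu>)))"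

definition locally_lipschitz :: "('a::metric_space \<Rightarrow> real) \<Rightarrow> bool" where
  "locally_lipschitz u \<longleftrightarrow> (\<forall>x. \<exists>r>0. \<exists>L. L-lipschitz_on (ball x r) u)"

definition loc_lip_approx ::
  "'a::metric_space measure \<Rightarrow> (nat \<Rightarrow> 'a \<Rightarrow> real) \<Rightarrow> ('a \<Rightarrow> real) \<Rightarrow> bool" where
  "loc_lip_approx \<nu> v u \<longleftrightarrow>
     (\<forall>n. locally_lipschitz (v n) \<and> integrable \<nu> (v n)) \<and>
     (\<lambda>n. LINT x|\<nu>. \<bar>v n x - u x\<bar>) \<longlonglongrightarrow> 0"

definition BV :: "'a::metric_space measure \<Rightarrow> ('a \<Rightarrow> real) set" where
  "BV \<nu> = {u. integrable \<nu> u \<and>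
     (\<exists>v. loc_lip_approx \<nu> v u \<and> (SUP n. \<integral>\<^sup>+x. slope (v n) x \<partial>\<nu>) < \<infinity>)}"

definition total_variation :: "'a::metric_space measure \<Rightarrow> ('a \<Rightarrow> real) \<Rightarrow> ennreal" where
  "total_variation \<nu> u =
     Inf {liminf (\<lambda>n. \<integral>\<^sup>+x. slope (v n) x \<partial>\<nu>) |v. loc_lip_approx \<nu> v u}"

definition step_walk :: "'a::metric_space measure \<Rightarrow> real \<Rightarrow> 'a \<Rightarrow> 'a measure" where
  "step_walk \<nu> \<epsilon> x = uniform_measure \<nu> (ball x \<epsilon>)"

definition walk_TV ::
  "'a measure \<Rightarrow> ('a \<Rightarrow> 'a measure) \<Rightarrow> ('a \<Rightarrow> real) \<Rightarrow> ennreal" where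
  "walk_TV \<nu> m u = 1 / 2 * (\<integral>\<^sup>+x. (\<integral>\<^sup>+y. ennreal \<bar>u y - u x\<bar> \<partial>m x) \<partial>\<nu>)"

lemma walk_TV_step_walk:
  assumes "sets \<nu> = sets borel" "u \<in> borel_measurable \<nu>"
  shows "walk_TV \<nu> (step_walk \<nu> \<epsilon>) u =
    1 / 2 * (\<integral>\<^sup>+x. 1 / emeasure \<nu> (ball x \<epsilon>) * (\<integral>\<^sup>+y\<in>ball x \<epsilon>. ennreal \<bar>u y - u x\<bar> \<partial>\<nu>) \<partial>\<nu>)"
proof -
  have "(\<integral>\<^sup>+y. ennreal \<bar>u y - u x\<bar> \<partial>step_walk \<nu> \<epsilon> x) =
      1 / emeasure \<nu> (ball x \<epsilon>) * (\<integral>\<^sup>+y\<in>ball x \<epsilon>. ennreal \<bar>u y - u x\<bar> \<partial>\<nu>)" for x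
    unfolding step_walk_def using assms
    by (subst nn_integral_uniform_measure) (auto simp: divide_ennreal_def mult.commute)
  then show ?thesis
    by (simp add: walk_TV_def)
qed

end

theory Submission
  imports Defs
begin

text \<open>Write \<open>E\<^sub>r(u)\<close> for the integral over \<open>x\<close> of the mean of \<open>|u(y) - u(x)|\<close> over \<open>y \<in> B(x, r)\<close>, so that
  the rescaled variation of the walk is \<open>E\<^sub>r(u) / (2 r)\<close>.  The estimates behind both
  inequalities are made at a fixed scale \<open>r\<close>.  Integrals over the centres of balls, exchanged by
  Tonelli's theorem, take the place of coverings of the space by balls.

  To bound the energy by the total variation, take first a locally Lipschitz \<open>v\<close>.  The triangle inequality through a
  constant on a ball \<open>B(z, 2 r)\<close>, averaged over \<open>z\<close>, bounds \<open>E\<^sub>r(v)\<close> by mean deviations of \<open>v\<close> on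
  such balls (\<open>energy_le_mean_deviation\<close>).  The Poincare inequality turns these into integrals of the
  slope over balls of radius \<open>2 \<Lambda> r\<close>, and averaging over balls is bounded on \<open>L\<^sup>1\<close>
  (\<open>averaging_bound\<close>), so \<open>E\<^sub>r(v) \<le> K r \<integral> |\<nabla>v|\<close> (\<open>energy_le_slope\<close>).  Since \<open>E\<^sub>r\<close> is continuous in \<open>L\<^sup>1\<close>
  for fixed \<open>r\<close>, the bound passes to the lower limit along any approximating sequence
  (\<open>energy_le_liminf_slope\<close>).  The Poincare inequality is postulated for globally Lipschitz functions
  only; it extends to locally Lipschitz ones because a complete doubling space has compact closed balls
  (\<open>compact_cball\<close>), on which a locally Lipschitz function is Lipschitz and can be extended.

  Conversely, let \<open>u\<^sub>r(x)\<close> be the average of \<open>u\<close> against a bump of slope \<open>2 / r\<close>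
  around \<open>x\<close>.  Subtracting the constant \<open>u(x)\<close> before averaging shows that \<open>|\<nabla>u\<^sub>r|(x)\<close> and
  \<open>|u\<^sub>r(x) - u(x)|\<close> are at most \<open>K / r\<close> and \<open>K\<close> times the mean of \<open>|u - u(x)|\<close> over \<open>B(x, r)\<close>.
  Integrating, \<open>\<integral> |\<nabla>u\<^sub>r| \<le> K E\<^sub>r(u) / r\<close> and \<open>\<parallel>u\<^sub>r - u\<parallel>\<^sub>1 \<le> K E\<^sub>r(u)\<close> (\<open>smooth_estimates\<close>).  Along scales \<open>r \<rightarrow> 0\<close>
  that nearly realise the lower limit of \<open>E\<^sub>r(u) / r\<close>, the functions \<open>u\<^sub>r\<close> therefore witness both
  membership in \<open>BV\<close> and the bound on the total variation (\<open>approximation_of_walk_TV\<close>).\<close>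

section \<open>The slope of a continuous function\<close>

text \<open>For fixed \<open>y\<close> the difference quotient, set to \<open>0\<close> unless \<open>0 < d(x, y) < e\<close>, is continuous in \<open>x\<close> on
  an open set and \<open>0\<close> outside it, hence lower semicontinuous; so is its supremum over \<open>y\<close>.  The slope
  is the infimum of these suprema over the radii \<open>e = 1 / (n + 1)\<close>.\<close>

lemma slope_borel_measurable:
  fixes u :: "'a::metric_space \<Rightarrow> real"
  assumes u: "continuous_on UNIV u"
  shows "slope u \<in> borel_measurable borel"
proof -
  define q where "q = (\<lambda>x y. ennreal (\<bar>u y - u x\<bar> / dist x y))"
  define S where "S = (\<lambda>e x. SUP y\<in>ball x e - {x}. q x y)"
  have S_meas: "S e \<in> borel_measurable borel" for e
  proof (rule borel_measurableI_greater)
    fix a :: ennreal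
    have "{x. a < S e x} = (\<Union>y. {x \<in> ball y e - {y}. a < q x y})"
      unfolding S_def less_SUP_iff by (auto simp: dist_commute)
    moreover have "open {x \<in> ball y e - {y}. a < q x y}" for y
    proof -
      have c: "continuous_on (ball y e - {y}) (\<lambda>x. q x y)"
        unfolding q_def
        by (intro continuous_on_ennreal continuous_intros continuous_on_subset[OF u]) auto
      have "open (ball y e - {y})" by (simp add: open_delete)
      then have "open ((\<lambda>x. q x y) -` {a<..} \<inter> (ball y e - {y}))"
        using c continuous_on_open_vimage open_greaterThan by blast
      moreover have "(\<lambda>x. q x y) -` {a<..} \<inter> (ball y e - {y}) = {x \<in> ball y e - {y}. a < q x y}"
        by auto
      ultimately show ?thesis by simp
    qed
    ultimately have "open {x. a < S e x}" by auto
    then show "{x \<in> space borel. a < S e x} \<in> sets borel" by simp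
  qed
  have "slope u x = (INF n. S (1 / real (Suc n)) x)" for x
    unfolding slope_def Limsup_at
  proof (rule antisym)
    show "(INF e\<in>{0<..}. SUP y\<in>ball x e - {x}. ennreal (\<bar>u y - u x\<bar> / dist x y))
        \<le> (INF n. S (1 / real (Suc n)) x)"
      unfolding S_def q_def by (rule INF_mono) (auto intro!: bexI[of _ "1 / real (Suc _)"])
    show "(INF n. S (1 / real (Suc n)) x)
        \<le> (INF e\<in>{0<..}. SUP y\<in>ball x e - {x}. ennreal (\<bar>u y - u x\<bar> / dist x y))"
    proof (rule INF_greatest)
      fix e :: real assume "e \<in> {0<..}"
      then obtain n where n: "1 / real (Suc n) < e"
        using nat_approx_posE by auto
      have "(INF n. S (1 / real (Suc n)) x) \<le> S (1 / real (Suc n)) x"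
        by (rule INF_lower) simp
      also have "\<dots> \<le> (SUP y\<in>ball x e - {x}. ennreal (\<bar>u y - u x\<bar> / dist x y))"
        unfolding S_def q_def using n by (intro SUP_subset_mono) auto
      finally show "(INF n. S (1 / real (Suc n)) x)
          \<le> (SUP y\<in>ball x e - {x}. ennreal (\<bar>u y - u x\<bar> / dist x y))" .
    qed
  qed
  then have "slope u = (\<lambda>x. INF n. S (1 / real (Suc n)) x)" by auto
  then show ?thesis using S_meas by simp
qed

lemma slope_cong_open:
  assumes "open S" "x \<in> S" "\<And>y. y \<in> S \<Longrightarrow> u y = v y"
  shows "slope u x = slope v x"
  unfolding slope_def
proof (rule Limsup_eq)
  have "\<forall>\<^sub>F y in at x. y \<in> S"
    using assms eventually_at_topological by blast
  then show "\<forall>\<^sub>F y in at x. ennreal (\<bar>u y - u x\<bar> / dist x y) = ennreal (\<bar>v y - v x\<bar> / dist x y)"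
    by eventually_elim (use assms in simp)
qed

lemma slope_le:
  assumes "0 < r" "\<And>y. dist x y < r \<Longrightarrow> \<bar>u y - u x\<bar> \<le> M * dist x y"
  shows "slope u x \<le> ennreal M"
  unfolding slope_def
proof (rule Limsup_bounded)
  show "\<forall>\<^sub>F y in at x. ennreal (\<bar>u y - u x\<bar> / dist x y) \<le> ennreal M"
    unfolding eventually_at
    using assms by (intro exI[of _ r]) (auto simp: dist_commute divide_le_eq intro!: ennreal_leI)
qed

section \<open>Locally Lipschitz functions\<close>

lemma locally_lipschitz_continuous:
  assumes "locally_lipschitz u"
  shows "continuous_on UNIV u"
proof -
  have "isCont u x" for x
  proof -
    obtain r L where "0 < r" "L-lipschitz_on (ball x r) u"
      using assms unfolding locally_lipschitz_def by blast
    then show ?thesis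
      using lipschitz_on_continuous_on[of L "ball x r" u] continuous_on_interior[of "ball x r" u x]
      by simp
  qed
  then show ?thesis by (simp add: continuous_at_imp_continuous_on)
qed

lemma locally_lipschitz_compact:
  assumes "locally_lipschitz u" "compact S"
  obtains L where "L-lipschitz_on S u"
proof -
  have "local_lipschitz {0::real} S (\<lambda>_. u)"
    unfolding local_lipschitz_def
  proof (intro ballI)
    fix x assume "x \<in> S"
    obtain r L where r: "0 < r" "L-lipschitz_on (ball x r) u"
      using assms(1) unfolding locally_lipschitz_def by blast
    have "cball x (r / 2) \<inter> S \<subseteq> ball x r" using r by auto
    then have "L-lipschitz_on (cball x (r / 2) \<inter> S) u"
      using r lipschitz_on_subset by blast
    then show "\<exists>w>0. \<exists>L. \<forall>t\<in>cball t w \<inter> {0}. L-lipschitz_on (cball x w \<inter> S) u" for t :: real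
      using r by (intro exI[of _ "r / 2"]) auto
  qed
  from local_lipschitz_compact_implies_lipschitz[OF this \<open>compact S\<close>]
  show ?thesis using that by auto
qed

text \<open>The McShane extension \<open>x \<mapsto> inf\<^sub>y (u y + L d(x, y))\<close>.\<close>

lemma lipschitz_extension:
  fixes u :: "'a::metric_space \<Rightarrow> real"
  assumes u: "L-lipschitz_on S u" and S: "S \<noteq> {}"
  obtains w where "L-lipschitz_on UNIV w" "\<And>x. x \<in> S \<Longrightarrow> w x = u x"
proof -
  have L: "0 \<le> L" using u by (rule lipschitz_on_nonneg)
  define w where "w = (\<lambda>x. INF y\<in>S. u y + L * dist x y)"
  have bdd: "bdd_below ((\<lambda>y. u y + L * dist x y) ` S)" for x
  proof -
    obtain s where s: "s \<in> S" using S by auto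
    have "u s - L * dist s x \<le> u y + L * dist x y" if "y \<in> S" for y
    proof -
      have "\<bar>u s - u y\<bar> \<le> L * dist s y"
        using lipschitz_onD[OF u s that] by (simp add: dist_real_def)
      also have "\<dots> \<le> L * (dist s x + dist x y)"
        by (intro mult_left_mono dist_triangle L)
      finally show ?thesis by (simp add: algebra_simps)
    qed
    then show ?thesis by (auto intro!: bdd_belowI2)
  qed
  have half: "w x \<le> w x' + L * dist x x'" for x x'
  proof -
    have "w x - L * dist x x' \<le> u y + L * dist x' y" if "y \<in> S" for y
    proof -
      have "w x \<le> u y + L * dist x y"
        unfolding w_def using bdd that by (rule cINF_lower)
      also have "\<dots> \<le> u y + L * (dist x x' + dist x' y)"
        by (intro add_left_mono mult_left_mono dist_triangle L)
      finally show ?thesis by (simp add: algebra_simps)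
    qed
    then have "w x - L * dist x x' \<le> w x'"
      unfolding w_def using S by (intro cINF_greatest) (auto simp: w_def)
    then show ?thesis by simp
  qed
  have "L-lipschitz_on UNIV w"
  proof (rule lipschitz_onI[OF _ L])
    fix x y
    show "dist (w x) (w y) \<le> L * dist x y"
      using half[of x y] half[of y x] by (simp add: dist_real_def abs_le_iff dist_commute)
  qed
  moreover have "w x = u x" if x: "x \<in> S" for x
  proof (rule antisym)
    show "w x \<le> u x" unfolding w_def using cINF_lower[OF bdd[of x] x] by simp
    have "u x \<le> u y + L * dist x y" if "y \<in> S" for y
      using lipschitz_onD[OF u x that] by (simp add: dist_real_def)
    then show "u x \<le> w x" unfolding w_def using S by (intro cINF_greatest) auto
  qed
  ultimately show ?thesis using that by blast
qed

section \<open>Doubling measures\<close>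

locale doubling_measure =
  fixes \<nu> :: "'a::polish_space measure" and C :: real
  assumes sets_eq: "sets \<nu> = sets borel"
    and C_ge_1: "1 \<le> C"
    and ball_pos: "0 < r \<Longrightarrow> 0 < emeasure \<nu> (ball x r)"
    and ball_finite: "emeasure \<nu> (ball x r) < \<infinity>"
    and ball_double: "0 < r \<Longrightarrow> measure \<nu> (ball x (2 * r)) \<le> C * measure \<nu> (ball x r)"
begin

declare sets_eq [measurable_cong]

lemma space_eq [simp]: "space \<nu> = UNIV"
  using sets_eq_imp_space_eq[OF sets_eq] by simp

sublocale sigma_finite_measure \<nu>
proof
  obtain x0 :: 'a where True by simp
  have "(\<Union>n. ball x0 (real n)) = UNIV"
    using reals_Archimedean2 by (auto simp: set_eq_iff)
  then show "\<exists>A. countable A \<and> A \<subseteq> sets \<nu> \<and> \<Union>A = space \<nu> \<and> (\<forall>a\<in>A. emeasure \<nu> a \<noteq> \<infinity>)"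
    using ball_finite
    by (intro exI[of _ "range (\<lambda>n. ball x0 (real n))"]) (auto simp: sets_eq less_top[symmetric])
qed

sublocale pair: pair_sigma_finite \<nu> \<nu> ..

abbreviation vol :: "real \<Rightarrow> 'a \<Rightarrow> real" where
  "vol r x \<equiv> measure \<nu> (ball x r)"

lemma emeasure_ball: "emeasure \<nu> (ball x r) = ennreal (vol r x)"
  using ball_finite[of x r] by (simp add: emeasure_eq_ennreal_measure)

lemma vol_pos: "0 < r \<Longrightarrow> 0 < vol r x"
  using ball_pos[of r x] by (simp add: emeasure_ball)

lemma vol_iterate: "0 < r \<Longrightarrow> vol (2 ^ j * r) x \<le> C ^ j * vol r x"
proof (induction j)
  case (Suc j)
  have "vol (2 * (2 ^ j * r)) x \<le> C * vol (2 ^ j * r) x"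
    using Suc by (intro ball_double) simp
  also have "\<dots> \<le> C * (C ^ j * vol r x)"
    using Suc C_ge_1 by (intro mult_left_mono) auto
  finally show ?case by (simp add: mult.assoc)
qed simp

lemma vol_mono: "ball y s \<subseteq> ball x r \<Longrightarrow> vol s y \<le> vol r x"
  by (intro measure_mono_fmeasurable fmeasurableI) (use ball_finite in \<open>auto simp: sets_eq\<close>)

lemma vol_compare:
  assumes "0 < r" "dist x y + s \<le> 2 ^ j * r"
  shows "vol s y \<le> C ^ j * vol r x"
proof -
  have "dist x z < 2 ^ j * r" if "dist y z < s" for z :: 'a
    using that assms(2) dist_triangle[of x z y] by linarith
  then have "ball y s \<subseteq> ball x (2 ^ j * r)" by auto
  then have "vol s y \<le> vol (2 ^ j * r) x" by (rule vol_mono)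
  then show ?thesis using vol_iterate[OF assms(1), of x j] by linarith
qed

lemma indicator_ball_measurable [measurable]:
  "(\<lambda>(x, y). indicator (ball x r) y :: ennreal) \<in> borel_measurable (\<nu> \<Otimes>\<^sub>M \<nu>)"
proof -
  have "(\<lambda>(x :: 'a, y). indicator (ball x r) y :: ennreal)
      = (\<lambda>p. if dist (fst p) (snd p) < r then 1 else 0)"
    by (auto simp: indicator_def fun_eq_iff)
  moreover have "\<dots> \<in> borel_measurable (\<nu> \<Otimes>\<^sub>M \<nu>)" by measurable
  ultimately show ?thesis by simp
qed

lemma vol_measurable [measurable]: "vol r \<in> borel_measurable \<nu>"
proof -
  have "(\<lambda>x. \<integral>\<^sup>+y. indicator (ball x r) y \<partial>\<nu>) \<in> borel_measurable \<nu>"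
    by (rule borel_measurable_nn_integral) simp
  then have "(\<lambda>x. emeasure \<nu> (ball x r)) \<in> borel_measurable \<nu>" by (simp add: sets_eq)
  then show ?thesis unfolding measure_def by simp
qed

text \<open>The averaging operator \<open>f \<mapsto> (z \<mapsto> \<integral>\<^bsub>B(z,R)\<^esub> f / \<nu>(B(z,r)))\<close> is bounded on \<open>L\<^sup>1\<close>:
  its adjoint maps \<open>1\<close> to \<open>w \<mapsto> \<integral>\<^bsub>B(w,R)\<^esub> d\<nu>(z) / \<nu>(B(z,r))\<close>, and doubling bounds this by
  a constant.\<close>

lemma averaging_bound:
  assumes f [measurable]: "f \<in> borel_measurable \<nu>" and r: "0 < r" and R: "2 * R \<le> 2 ^ j * r"
  shows "(\<integral>\<^sup>+z. ennreal (1 / vol r z) * (\<integral>\<^sup>+w\<in>ball z R. f w \<partial>\<nu>) \<partial>\<nu>)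
    \<le> ennreal (C ^ j) * (\<integral>\<^sup>+w. f w \<partial>\<nu>)"
proof -
  have adj: "(\<integral>\<^sup>+z. ennreal (1 / vol r z) * indicator (ball z R) w \<partial>\<nu>) \<le> ennreal (C ^ j)" for w
  proof (cases "0 < R")
    case True
    have "(\<integral>\<^sup>+z. ennreal (1 / vol r z) * indicator (ball z R) w \<partial>\<nu>)
        \<le> (\<integral>\<^sup>+z. ennreal (C ^ j / vol R w) * indicator (ball w R) z \<partial>\<nu>)"
    proof (rule nn_integral_mono)
      fix z
      have "1 / vol r z \<le> C ^ j / vol R w" if "dist z w < R"
        using vol_compare[of r z w R j] that r R vol_pos[OF r, of z] vol_pos[OF True, of w]
        by (simp add: field_simps)
      then show "ennreal (1 / vol r z) * indicator (ball z R) w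
          \<le> ennreal (C ^ j / vol R w) * indicator (ball w R) z"
        by (auto simp: indicator_def dist_commute intro!: ennreal_leI)
    qed
    also have "\<dots> = ennreal (C ^ j / vol R w) * ennreal (vol R w)"
      by (subst nn_integral_cmult_indicator) (auto simp: sets_eq emeasure_ball)
    also have "\<dots> = ennreal (C ^ j)"
      using vol_pos[OF True, of w] C_ge_1 by (simp flip: ennreal_mult')
    finally show ?thesis .
  qed (simp add: ball_empty)
  have "(\<integral>\<^sup>+z. ennreal (1 / vol r z) * (\<integral>\<^sup>+w\<in>ball z R. f w \<partial>\<nu>) \<partial>\<nu>)
      = (\<integral>\<^sup>+z. \<integral>\<^sup>+w. ennreal (1 / vol r z) * (f w * indicator (ball z R) w) \<partial>\<nu> \<partial>\<nu>)"
    by (intro nn_integral_cong nn_integral_cmult[symmetric]) (simp add: sets_eq)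
  also have "\<dots> = (\<integral>\<^sup>+w. \<integral>\<^sup>+z. ennreal (1 / vol r z) * (f w * indicator (ball z R) w) \<partial>\<nu> \<partial>\<nu>)"
    by (rule pair.Fubini'[symmetric]) measurable
  also have "\<dots> = (\<integral>\<^sup>+w. f w * (\<integral>\<^sup>+z. ennreal (1 / vol r z) * indicator (ball z R) w \<partial>\<nu>) \<partial>\<nu>)"
    by (intro nn_integral_cong, subst nn_integral_cmult[symmetric]) (auto simp: ac_simps)
  also have "\<dots> \<le> (\<integral>\<^sup>+w. f w * ennreal (C ^ j) \<partial>\<nu>)"
    by (intro nn_integral_mono mult_left_mono adj) simp
  also have "\<dots> = ennreal (C ^ j) * (\<integral>\<^sup>+w. f w \<partial>\<nu>)"
    by (simp add: nn_integral_multc mult.commute)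
  finally show ?thesis .
qed

text \<open>Disjoint balls \<open>B(s, e/2)\<close> with centres in \<open>B(x, R)\<close> have volume comparable to that of
  \<open>B(x, R + e)\<close>, so an \<open>e\<close>-separated set in \<open>B(x, R)\<close> has boundedly many points.  One of maximal
  size is a finite \<open>e\<close>-net.\<close>

lemma compact_cball:
  fixes x :: 'a
  shows "compact (cball x R)"
proof -
  have "\<exists>k. finite k \<and> cball x R \<subseteq> (\<Union>s\<in>k. ball s e)" if e: "0 < e" for e
  proof -
    define P where "P = (\<lambda>S. finite S \<and> S \<subseteq> cball x R \<and> (\<forall>s\<in>S. \<forall>t\<in>S. s \<noteq> t \<longrightarrow> e \<le> dist s t))"
    define R' where "R' = \<bar>R\<bar> + e"
    have R': "0 < R'" using e by (simp add: R'_def)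
    obtain j where "(4 * R') / e < 2 ^ j" using real_arch_pow[of 2] by auto
    then have j: "2 * R' \<le> 2 ^ j * (e / 2)" using e by (simp add: field_simps)
    have card: "real (card S) \<le> C ^ j" if "P S" for S
    proof -
      have fin: "finite S" and sub: "S \<subseteq> cball x R"
        and sep: "\<And>s t. s \<in> S \<Longrightarrow> t \<in> S \<Longrightarrow> s \<noteq> t \<Longrightarrow> e \<le> dist s t"
        using that by (auto simp: P_def)
      have disj: "disjoint_family_on (\<lambda>s. ball s (e / 2)) S"
        unfolding disjoint_family_on_def
      proof (intro ballI impI)
        fix s t assume st: "s \<in> S" "t \<in> S" "s \<noteq> t"
        have "z \<notin> ball t (e / 2)" if "z \<in> ball s (e / 2)" for z
          using sep[OF st] that dist_triangle[of s t z] by (auto simp: dist_commute)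
        then show "ball s (e / 2) \<inter> ball t (e / 2) = {}" by auto
      qed
      have "real (card S) * (vol R' x / C ^ j) = (\<Sum>s\<in>S. vol R' x / C ^ j)" by simp
      also have "\<dots> \<le> (\<Sum>s\<in>S. vol (e / 2) s)"
      proof (rule sum_mono)
        fix s assume "s \<in> S"
        then have "dist s x + R' \<le> 2 ^ j * (e / 2)"
          using sub j e by (auto simp: R'_def dist_commute)
        then show "vol R' x / C ^ j \<le> vol (e / 2) s"
          using vol_compare[of "e / 2" s x R' j] e C_ge_1 by (simp add: field_simps)
      qed
      also have "\<dots> = measure \<nu> (\<Union>s\<in>S. ball s (e / 2))"
        using fin disj ball_finite
        by (intro measure_finite_Union[symmetric]) (auto simp: sets_eq less_top[symmetric])
      also have "\<dots> \<le> vol R' x"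
      proof (intro measure_mono_fmeasurable fmeasurableI)
        show "(\<Union>s\<in>S. ball s (e / 2)) \<subseteq> ball x R'"
        proof
          fix z assume "z \<in> (\<Union>s\<in>S. ball s (e / 2))"
          then obtain s where "s \<in> S" "dist s z < e / 2" by auto
          then show "z \<in> ball x R'"
            using sub e dist_triangle[of x z s] by (auto simp: R'_def)
        qed
      qed (use ball_finite fin in \<open>auto simp: sets_eq\<close>)
      finally show ?thesis
        using vol_pos[OF R', of x] C_ge_1 by (simp add: field_simps)
    qed
    have "card S < Suc (nat \<lceil>C ^ j\<rceil>)" if "P S" for S
      using card[OF that] by linarith
    moreover have "P {}" by (simp add: P_def)
    ultimately obtain S where S: "P S" "\<And>T. P T \<Longrightarrow> card T \<le> card S"
      using ex_has_greatest_nat[of P "{}" card "Suc (nat \<lceil>C ^ j\<rceil>)"] by blast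
    have "cball x R \<subseteq> (\<Union>s\<in>S. ball s e)"
    proof
      fix z assume z: "z \<in> cball x R"
      show "z \<in> (\<Union>s\<in>S. ball s e)"
      proof (rule ccontr)
        assume n: "z \<notin> (\<Union>s\<in>S. ball s e)"
        then have "P (insert z S)" and "z \<notin> S"
          using S(1) z e by (auto simp: P_def not_less dist_commute)
        then show False using S(2)[of "insert z S"] S(1) by (simp add: P_def)
      qed
    qed
    then show ?thesis using S(1) by (auto simp: P_def)
  qed
  then show ?thesis
    by (simp add: compact_eq_totally_bounded complete_eq_closed)
qed

section \<open>The oscillation energy\<close>

definition osc :: "real \<Rightarrow> ('a \<Rightarrow> real) \<Rightarrow> 'a \<Rightarrow> ennreal" where
  "osc r u x = ennreal (1 / vol r x) * (\<integral>\<^sup>+y\<in>ball x r. ennreal \<bar>u y - u x\<bar> \<partial>\<nu>)"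

definition energy :: "real \<Rightarrow> ('a \<Rightarrow> real) \<Rightarrow> ennreal" where
  "energy r u = (\<integral>\<^sup>+x. osc r u x \<partial>\<nu>)"

lemma osc_measurable [measurable]:
  assumes [measurable]: "u \<in> borel_measurable \<nu>"
  shows "osc r u \<in> borel_measurable \<nu>"
  unfolding osc_def[abs_def] by measurable

lemma walk_TV_eq_energy:
  assumes "u \<in> borel_measurable \<nu>" "0 < r"
  shows "ennreal (1 / r) * walk_TV \<nu> (step_walk \<nu> r) u = ennreal (1 / (2 * r)) * energy r u"
proof -
  have "1 / emeasure \<nu> (ball x r) = ennreal (1 / vol r x)" for x
    using vol_pos[OF assms(2), of x] by (simp add: emeasure_ball divide_ennreal flip: ennreal_1)
  then have "walk_TV \<nu> (step_walk \<nu> r) u = ennreal (1 / 2) * energy r u"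
    by (simp add: walk_TV_step_walk[OF sets_eq assms(1)] energy_def osc_def divide_ennreal
        flip: ennreal_1 ennreal_numeral)
  moreover have "ennreal (1 / r) * ennreal (1 / 2) = ennreal (1 / (2 * r))"
    using assms(2) by (subst ennreal_mult'[symmetric]) auto
  ultimately show ?thesis by (simp only: mult.assoc[symmetric])
qed

lemma nn_integral_ball_const: "(\<integral>\<^sup>+y\<in>ball x r. k \<partial>\<nu>) = k * ennreal (vol r x)"
  by (simp add: nn_integral_cmult_indicator sets_eq emeasure_ball)

lemma ennreal_inverse_vol: "0 < r \<Longrightarrow> ennreal (1 / vol r x) * ennreal (vol r x) = 1"
  using vol_pos[of r x] by (simp flip: ennreal_mult')

text \<open>At a fixed scale the energy is continuous in \<open>L\<^sup>1\<close>: the triangle inequality leaves the average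
  of \<open>|u - v|\<close> over balls and \<open>|u - v|\<close> itself.\<close>

lemma energy_L1_perturbation:
  assumes [measurable]: "u \<in> borel_measurable \<nu>" "v \<in> borel_measurable \<nu>" and r: "0 < r"
  shows "energy r u \<le> energy r v + ennreal (C + 1) * (\<integral>\<^sup>+x. ennreal \<bar>v x - u x\<bar> \<partial>\<nu>)"
proof -
  define d where "d = (\<lambda>x. ennreal \<bar>v x - u x\<bar>)"
  have [measurable]: "d \<in> borel_measurable \<nu>" unfolding d_def by measurable
  have "osc r u x \<le> osc r v x + (ennreal (1 / vol r x) * (\<integral>\<^sup>+y\<in>ball x r. d y \<partial>\<nu>) + d x)" for x
  proof -
    have "(\<integral>\<^sup>+y\<in>ball x r. ennreal \<bar>u y - u x\<bar> \<partial>\<nu>)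
        \<le> (\<integral>\<^sup>+y. ennreal \<bar>v y - v x\<bar> * indicator (ball x r) y
              + (d y * indicator (ball x r) y + d x * indicator (ball x r) y) \<partial>\<nu>)"
      unfolding d_def
      by (intro nn_integral_mono) (auto simp: indicator_def simp flip: ennreal_plus intro!: ennreal_leI)
    also have "\<dots> = (\<integral>\<^sup>+y\<in>ball x r. ennreal \<bar>v y - v x\<bar> \<partial>\<nu>)
        + ((\<integral>\<^sup>+y\<in>ball x r. d y \<partial>\<nu>) + d x * ennreal (vol r x))"
      by (simp add: nn_integral_add nn_integral_ball_const sets_eq)
    finally have "osc r u x \<le> ennreal (1 / vol r x) * \<dots>"
      unfolding osc_def by (rule mult_left_mono) simp
    also have "\<dots> = osc r v x + (ennreal (1 / vol r x) * (\<integral>\<^sup>+y\<in>ball x r. d y \<partial>\<nu>)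
        + (ennreal (1 / vol r x) * ennreal (vol r x)) * d x)"
      by (simp add: osc_def distrib_left ac_simps)
    finally show ?thesis by (simp only: ennreal_inverse_vol[OF r] mult_1)
  qed
  then have "energy r u
      \<le> (\<integral>\<^sup>+x. osc r v x + (ennreal (1 / vol r x) * (\<integral>\<^sup>+y\<in>ball x r. d y \<partial>\<nu>) + d x) \<partial>\<nu>)"
    unfolding energy_def by (rule nn_integral_mono)
  also have "\<dots> = energy r v
      + ((\<integral>\<^sup>+x. ennreal (1 / vol r x) * (\<integral>\<^sup>+y\<in>ball x r. d y \<partial>\<nu>) \<partial>\<nu>) + (\<integral>\<^sup>+x. d x \<partial>\<nu>))"
    by (simp add: nn_integral_add energy_def)
  also have "\<dots> \<le> energy r v + (ennreal (C ^ 1) * (\<integral>\<^sup>+x. d x \<partial>\<nu>) + (\<integral>\<^sup>+x. d x \<partial>\<nu>))"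
    using r by (intro add_mono averaging_bound order_refl) auto
  also have "\<dots> = energy r v + ennreal (C + 1) * (\<integral>\<^sup>+x. d x \<partial>\<nu>)"
    using C_ge_1 by (simp add: distrib_right ennreal_plus)
  finally show ?thesis by (simp add: d_def)
qed

text \<open>Averaging over auxiliary centres \<open>z \<in> B(x, r)\<close> replaces a covering of the space by balls.  When
  \<open>d(x, z) < r\<close>, the ball \<open>B(x, r)\<close> lies in \<open>B(z, 2 r)\<close> and has comparable volume.  By the triangle
  inequality through \<open>a z\<close>, the mean of \<open>|u(y) - u(x)|\<close> over the \<open>x, y\<close> near \<open>z\<close> is at most a constant
  times the mean deviation of \<open>u\<close> from \<open>a z\<close> on \<open>B(z, 2 r)\<close>.\<close>

lemma energy_le_mean_deviation:
  assumes [measurable]: "u \<in> borel_measurable \<nu>" and r: "0 < r"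
  shows "energy r u \<le> (\<integral>\<^sup>+z. ennreal (2 * C ^ 4) *
    (ennreal (1 / vol (2 * r) z) * (\<integral>\<^sup>+y\<in>ball z (2 * r). ennreal \<bar>u y - a z\<bar> \<partial>\<nu>)) \<partial>\<nu>)"
proof -
  have "energy r u
      = (\<integral>\<^sup>+x. \<integral>\<^sup>+z. ennreal (1 / vol r x) * osc r u x * indicator (ball x r) z \<partial>\<nu> \<partial>\<nu>)"
    unfolding energy_def
  proof (rule nn_integral_cong)
    fix x
    have "(\<integral>\<^sup>+z. ennreal (1 / vol r x) * osc r u x * indicator (ball x r) z \<partial>\<nu>)
        = (ennreal (1 / vol r x) * ennreal (vol r x)) * osc r u x"
      by (subst nn_integral_ball_const) (simp add: ac_simps)
    then show "osc r u x = (\<integral>\<^sup>+z. ennreal (1 / vol r x) * osc r u x * indicator (ball x r) z \<partial>\<nu>)"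
      by (simp only: ennreal_inverse_vol[OF r] mult_1)
  qed
  also have "\<dots>
      = (\<integral>\<^sup>+z. \<integral>\<^sup>+x. ennreal (1 / vol r x) * osc r u x * indicator (ball x r) z \<partial>\<nu> \<partial>\<nu>)"
    by (rule pair.Fubini'[symmetric]) measurable
  also have "\<dots> \<le> (\<integral>\<^sup>+z. ennreal (2 * C ^ 4) *
    (ennreal (1 / vol (2 * r) z) * (\<integral>\<^sup>+y\<in>ball z (2 * r). ennreal \<bar>u y - a z\<bar> \<partial>\<nu>)) \<partial>\<nu>)"
  proof (rule nn_integral_mono)
    fix z :: 'a
    define B where "B = ball z (2 * r)"
    define V where "V = ennreal (vol (2 * r) z)"
    define W where "W = ennreal (1 / vol (2 * r) z)"
    define K where "K = ennreal (C ^ 2)"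
    define I where "I = (\<integral>\<^sup>+y\<in>B. ennreal \<bar>u y - a z\<bar> \<partial>\<nu>)"
    have [measurable]: "B \<in> sets \<nu>" by (simp add: B_def sets_eq)
    have WV: "W * V = 1"
      unfolding W_def V_def using r by (intro ennreal_inverse_vol) simp
    have eB: "emeasure \<nu> B = V" by (simp add: B_def V_def emeasure_ball)
    have compare: "ennreal (1 / vol r x) \<le> K * W" if "dist x z < r" for x
    proof -
      have "1 / vol r x \<le> C ^ 2 * (1 / vol (2 * r) z)"
        using vol_compare[of r x z "2 * r" 2] that r vol_pos[OF r, of x] vol_pos[of "2 * r" z]
        by (simp add: field_simps)
      then show ?thesis
        unfolding K_def W_def using C_ge_1 by (simp flip: ennreal_mult' add: ennreal_leI)
    qed
    have "ennreal (1 / vol r x) * osc r u x * indicator (ball x r) z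
        \<le> (K * W) * ((K * W) * (I + V * ennreal \<bar>u x - a z\<bar>)) * indicator B x" for x
    proof (cases "dist x z < r")
      case True
      have "(\<integral>\<^sup>+y\<in>ball x r. ennreal \<bar>u y - u x\<bar> \<partial>\<nu>)
          \<le> (\<integral>\<^sup>+y. ennreal \<bar>u y - a z\<bar> * indicator B y + ennreal \<bar>u x - a z\<bar> * indicator B y \<partial>\<nu>)"
      proof (rule nn_integral_mono)
        fix y
        have "y \<in> B" if "dist x y < r"
          using that True dist_triangle[of z y x] by (simp add: B_def dist_commute)
        then show "ennreal \<bar>u y - u x\<bar> * indicator (ball x r) y
            \<le> ennreal \<bar>u y - a z\<bar> * indicator B y + ennreal \<bar>u x - a z\<bar> * indicator B y"
          by (auto simp: indicator_def simp flip: ennreal_plus intro!: ennreal_leI)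
      qed
      also have "\<dots> = I + V * ennreal \<bar>u x - a z\<bar>"
        by (simp add: nn_integral_add nn_integral_cmult_indicator I_def eB) (simp add: mult.commute)
      finally have "osc r u x \<le> (K * W) * (I + V * ennreal \<bar>u x - a z\<bar>)"
        unfolding osc_def using compare[OF True] by (intro mult_mono) auto
      then have "ennreal (1 / vol r x) * osc r u x
          \<le> (K * W) * ((K * W) * (I + V * ennreal \<bar>u x - a z\<bar>))"
        using compare[OF True] by (intro mult_mono) auto
      then show ?thesis using True r by (simp add: B_def dist_commute)
    qed simp
    then have "(\<integral>\<^sup>+x. ennreal (1 / vol r x) * osc r u x * indicator (ball x r) z \<partial>\<nu>)
        \<le> (\<integral>\<^sup>+x. (K * W) * ((K * W) * (I + V * ennreal \<bar>u x - a z\<bar>)) * indicator B x \<partial>\<nu>)"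
      by (rule nn_integral_mono)
    also have "\<dots> = (\<integral>\<^sup>+x. (K * W * K * W) * (I * indicator B x
        + V * (ennreal \<bar>u x - a z\<bar> * indicator B x)) \<partial>\<nu>)"
      by (intro nn_integral_cong) (auto simp: indicator_def ac_simps)
    also have "\<dots> = (K * W * K * W) * (I * V + V * I)"
      by (simp add: nn_integral_cmult nn_integral_add nn_integral_cmult_indicator eB I_def)
    also have "\<dots> = (K * K * 2) * (W * I) * (W * V)"
      by (simp add: ac_simps mult_2[symmetric])
    also have "K * K * 2 = ennreal (2 * C ^ 4)"
      unfolding K_def using C_ge_1
      by (simp flip: ennreal_mult' ennreal_numeral add: power_add[symmetric] mult.commute)
    finally show "(\<integral>\<^sup>+x. ennreal (1 / vol r x) * osc r u x * indicator (ball x r) z \<partial>\<nu>)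
        \<le> ennreal (2 * C ^ 4) * (ennreal (1 / vol (2 * r) z)
            * (\<integral>\<^sup>+y\<in>ball z (2 * r). ennreal \<bar>u y - a z\<bar> \<partial>\<nu>))"
      unfolding WV by (simp add: W_def I_def B_def)
  qed
  finally show ?thesis .
qed

end

section \<open>The energy is controlled by the total variation\<close>

locale poincare_space = doubling_measure +
  fixes c \<Lambda> :: real
  assumes c_pos: "0 < c" and Lambda_ge_1: "1 \<le> \<Lambda>"
    and poincare_lipschitz: "L-lipschitz_on UNIV u \<Longrightarrow> 0 < r \<Longrightarrow>
      (\<integral>\<^sup>+y\<in>ball x r. ennreal \<bar>u y - ball_avg \<nu> u x r\<bar> \<partial>\<nu>)
        \<le> ennreal (c * r) * (\<integral>\<^sup>+y\<in>ball x (\<Lambda> * r). slope u y \<partial>\<nu>)"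
begin

text \<open>A locally Lipschitz function is Lipschitz on the compact ball of radius \<open>\<Lambda> r\<close>, and the
  inequality sees nothing of the function outside the open ball of that radius.\<close>

lemma poincare_locally_lipschitz:
  assumes u: "locally_lipschitz u" and r: "0 < r"
  shows "(\<integral>\<^sup>+y\<in>ball x r. ennreal \<bar>u y - ball_avg \<nu> u x r\<bar> \<partial>\<nu>)
    \<le> ennreal (c * r) * (\<integral>\<^sup>+y\<in>ball x (\<Lambda> * r). slope u y \<partial>\<nu>)"
proof -
  have rL: "r \<le> \<Lambda> * r" using Lambda_ge_1 r by simp
  obtain L where "L-lipschitz_on (cball x (\<Lambda> * r)) u"
    using locally_lipschitz_compact[OF u compact_cball] by blast
  moreover have "cball x (\<Lambda> * r) \<noteq> {}" using rL r by (simp add: not_less)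
  ultimately obtain w where w: "L-lipschitz_on UNIV w" "\<And>y. y \<in> cball x (\<Lambda> * r) \<Longrightarrow> w y = u y"
    using lipschitz_extension by blast
  have eq: "w y = u y" if "dist x y < r" for y using w(2) that rL by simp
  have "(LINT y:ball x r|\<nu>. w y) = (LINT y:ball x r|\<nu>. u y)"
    by (rule set_lebesgue_integral_cong) (auto simp: sets_eq eq)
  then have avg: "ball_avg \<nu> w x r = ball_avg \<nu> u x r" by (simp add: ball_avg_def)
  have slope: "slope w y = slope u y" if "dist x y < \<Lambda> * r" for y
    by (rule slope_cong_open[of "ball x (\<Lambda> * r)"]) (use that w(2) in auto)
  have "(\<integral>\<^sup>+y\<in>ball x r. ennreal \<bar>u y - ball_avg \<nu> u x r\<bar> \<partial>\<nu>)
      = (\<integral>\<^sup>+y\<in>ball x r. ennreal \<bar>w y - ball_avg \<nu> w x r\<bar> \<partial>\<nu>)"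
    by (intro nn_integral_cong) (auto simp: indicator_def eq avg)
  also have "\<dots> \<le> ennreal (c * r) * (\<integral>\<^sup>+y\<in>ball x (\<Lambda> * r). slope w y \<partial>\<nu>)"
    by (rule poincare_lipschitz[OF w(1) r])
  also have "(\<integral>\<^sup>+y\<in>ball x (\<Lambda> * r). slope w y \<partial>\<nu>) = (\<integral>\<^sup>+y\<in>ball x (\<Lambda> * r). slope u y \<partial>\<nu>)"
    by (intro nn_integral_cong) (auto simp: indicator_def slope)
  finally show ?thesis .
qed

text \<open>The exponent \<open>j\<close> counts the doublings from the radius \<open>2 r\<close>, at which the Poincare inequality is
  applied, to the radius \<open>4 \<Lambda> r\<close>, where \<open>2 \<Lambda> r\<close> is the radius over which the slope is averaged.\<close>

lemma energy_le_slope: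
  assumes v: "locally_lipschitz v" and r: "0 < r" and j: "2 * \<Lambda> \<le> 2 ^ j"
  shows "energy r v \<le> ennreal (4 * c * C ^ (4 + j) * r) * (\<integral>\<^sup>+x. slope v x \<partial>\<nu>)"
proof -
  have cont: "continuous_on UNIV v" by (rule locally_lipschitz_continuous[OF v])
  then have [measurable]: "v \<in> borel_measurable \<nu>"
    using borel_measurable_continuous_onI measurable_cong_sets[OF sets_eq refl] by blast
  have [measurable]: "slope v \<in> borel_measurable \<nu>"
    using slope_borel_measurable[OF cont] measurable_cong_sets[OF sets_eq refl] by blast
  have "energy r v \<le> (\<integral>\<^sup>+z. ennreal (2 * C ^ 4) * (ennreal (1 / vol (2 * r) z)
      * (\<integral>\<^sup>+y\<in>ball z (2 * r). ennreal \<bar>v y - ball_avg \<nu> v z (2 * r)\<bar> \<partial>\<nu>)) \<partial>\<nu>)"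
    by (rule energy_le_mean_deviation) (use r in auto)
  also have "\<dots> \<le> (\<integral>\<^sup>+z. ennreal (2 * C ^ 4) * (ennreal (1 / vol (2 * r) z)
      * (ennreal (c * (2 * r)) * (\<integral>\<^sup>+y\<in>ball z (\<Lambda> * (2 * r)). slope v y \<partial>\<nu>))) \<partial>\<nu>)"
    using r by (intro nn_integral_mono mult_left_mono poincare_locally_lipschitz v) auto
  also have "\<dots> = (\<integral>\<^sup>+z. (ennreal (2 * C ^ 4) * ennreal (c * (2 * r))) * (ennreal (1 / vol (2 * r) z)
      * (\<integral>\<^sup>+y\<in>ball z (\<Lambda> * (2 * r)). slope v y \<partial>\<nu>)) \<partial>\<nu>)"
    by (simp add: ac_simps)
  also have "\<dots> = (ennreal (2 * C ^ 4) * ennreal (c * (2 * r)))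
      * (\<integral>\<^sup>+z. ennreal (1 / vol (2 * r) z) * (\<integral>\<^sup>+y\<in>ball z (\<Lambda> * (2 * r)). slope v y \<partial>\<nu>) \<partial>\<nu>)"
    by (rule nn_integral_cmult) measurable
  also have "\<dots> \<le> (ennreal (2 * C ^ 4) * ennreal (c * (2 * r)))
      * (ennreal (C ^ j) * (\<integral>\<^sup>+x. slope v x \<partial>\<nu>))"
    using r j by (intro mult_left_mono averaging_bound) auto
  also have "\<dots> = ennreal (4 * c * C ^ (4 + j) * r) * (\<integral>\<^sup>+x. slope v x \<partial>\<nu>)"
    using C_ge_1 c_pos r
    by (simp add: mult.assoc[symmetric] power_add flip: ennreal_mult') (simp add: ac_simps)
  finally show ?thesis .
qed

text \<open>At a fixed scale the \<open>L\<^sup>1\<close> distance between \<open>v n\<close> and \<open>u\<close> costs only an error that tends to \<open>0\<close>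
  with \<open>n\<close>.\<close>

lemma energy_le_liminf_slope:
  assumes int_u: "integrable \<nu> u"
    and v: "loc_lip_approx \<nu> v u" and r: "0 < r" and j: "2 * \<Lambda> \<le> 2 ^ j"
  defines "K \<equiv> 4 * c * C ^ (4 + j)"
  shows "ennreal (1 / (K * r)) * energy r u \<le> liminf (\<lambda>n. \<integral>\<^sup>+x. slope (v n) x \<partial>\<nu>)"
proof (rule ccontr)
  define S where "S = (\<lambda>n. \<integral>\<^sup>+x. slope (v n) x \<partial>\<nu>)"
  define d where "d = (\<lambda>n. LINT x|\<nu>. \<bar>v n x - u x\<bar>)"
  have lip: "locally_lipschitz (v n)" and int_v: "integrable \<nu> (v n)" for n
    using v by (auto simp: loc_lip_approx_def)
  have d: "d \<longlonglongrightarrow> 0"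
    using v by (simp add: loc_lip_approx_def d_def)
  have K: "0 < K" using c_pos C_ge_1 by (simp add: K_def)
  define b where "b = (C + 1) / (K * r)"
  have bound: "ennreal (1 / (K * r)) * energy r u \<le> S n + ennreal (b * d n)" for n
  proof -
    have "(\<integral>\<^sup>+x. ennreal \<bar>v n x - u x\<bar> \<partial>\<nu>) = ennreal (d n)"
      unfolding d_def by (rule nn_integral_eq_integral) (use int_u int_v in auto)
    then have "energy r u \<le> energy r (v n) + ennreal (C + 1) * ennreal (d n)"
      using energy_L1_perturbation[OF borel_measurable_integrable[OF int_u]
          borel_measurable_integrable[OF int_v] r, of n] by simp
    also have "\<dots> \<le> ennreal (K * r) * S n + ennreal (C + 1) * ennreal (d n)"
      using energy_le_slope[OF lip r j, of n] by (intro add_mono) (auto simp: K_def S_def)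
    finally have "ennreal (1 / (K * r)) * energy r u
        \<le> ennreal (1 / (K * r)) * (ennreal (K * r) * S n + ennreal (C + 1) * ennreal (d n))"
      by (rule mult_left_mono) simp
    also have "\<dots> = (ennreal (1 / (K * r)) * ennreal (K * r)) * S n
        + ennreal (1 / (K * r)) * ennreal (C + 1) * ennreal (d n)"
      by (simp only: distrib_left mult.assoc)
    also have "ennreal (1 / (K * r)) * ennreal (K * r) = 1"
      using K r by (simp flip: ennreal_mult')
    also have "ennreal (1 / (K * r)) * ennreal (C + 1) * ennreal (d n) = ennreal (b * d n)"
      using K r C_ge_1
      by (simp add: b_def del: ennreal_plus flip: ennreal_mult')
    finally show ?thesis by simp
  qed
  assume "\<not> ennreal (1 / (K * r)) * energy r u \<le> liminf (\<lambda>n. \<integral>\<^sup>+x. slope (v n) x \<partial>\<nu>)"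
  then obtain X where X: "liminf S < X" "X < ennreal (1 / (K * r)) * energy r u"
    using dense by (auto simp: S_def not_le)
  have "(\<lambda>n. X + ennreal (b * d n)) \<longlonglongrightarrow> X + ennreal (b * 0)"
    by (intro tendsto_add tendsto_const tendsto_ennrealI tendsto_mult d)
  then have "\<forall>\<^sub>F n in sequentially. X + ennreal (b * d n) < ennreal (1 / (K * r)) * energy r u"
    using X(2) by (intro order_tendstoD(2)) auto
  then have "\<forall>\<^sub>F n in sequentially. X \<le> S n"
  proof eventually_elim
    case (elim n)
    then show ?case using bound[of n] add_right_mono[of "S n" X "ennreal (b * d n)"]
      by (meson linear not_le order.trans)
  qed
  then have "X \<le> liminf S" by (rule Liminf_bounded)
  then show False using X(1) by simp
qed

end

section \<open>Smoothing at a fixed scale\<close>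

context doubling_measure
begin

definition bump :: "real \<Rightarrow> 'a \<Rightarrow> 'a \<Rightarrow> real" where
  "bump r x y = max 0 (1 - 2 * dist x y / r)"

definition smooth :: "real \<Rightarrow> ('a \<Rightarrow> real) \<Rightarrow> 'a \<Rightarrow> real" where
  "smooth r u x = (LINT y|\<nu>. bump r x y * u y) / (LINT y|\<nu>. bump r x y)"

lemma bump_measurable [measurable]: "bump r x \<in> borel_measurable \<nu>"
  unfolding bump_def[abs_def] by measurable

lemma bump_nonneg: "0 \<le> bump r x y"
  by (simp add: bump_def)

text \<open>The support of \<open>bump r x\<close> has radius \<open>r / 2\<close>, so one ball of radius \<open>r\<close> contains the supports
  for all centres near its own.\<close>

lemma bump_le_indicator:
  assumes "0 < r" "dist x x' < r / 2"
  shows "bump r x' y \<le> indicator (ball x r) y"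
proof (cases "dist x y < r")
  case False
  then have "r / 2 \<le> dist x' y" using assms(2) dist_triangle[of x y x'] by simp
  then show ?thesis using assms(1) by (simp add: bump_def field_simps)
qed (use assms in \<open>simp add: bump_def\<close>)

lemma bump_lipschitz:
  assumes "0 < r" "dist x x' < r / 2"
  shows "\<bar>bump r x' y - bump r x y\<bar> \<le> 2 / r * dist x x' * indicator (ball x r) y"
proof (cases "dist x y < r")
  case True
  have "\<bar>dist x' y - dist x y\<bar> \<le> dist x x'"
    using dist_triangle[of x y x'] dist_triangle[of x' y x] by (simp add: dist_commute abs_le_iff)
  then have "2 / r * \<bar>dist x' y - dist x y\<bar> \<le> 2 / r * dist x x'"
    using assms(1) by (intro mult_left_mono) auto
  moreover have "2 / r * \<bar>dist x' y - dist x y\<bar> = \<bar>2 * dist x' y / r - 2 * dist x y / r\<bar>"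
    using assms(1) abs_mult[of "2 / r" "dist x' y - dist x y"] by (simp add: right_diff_distrib)
  ultimately have "\<bar>2 * dist x' y / r - 2 * dist x y / r\<bar> \<le> 2 / r * dist x x'"
    by simp
  then show ?thesis using True by (simp add: bump_def)
next
  case False
  then show ?thesis
    using bump_le_indicator[OF assms, of y] bump_le_indicator[OF assms(1), of x x y]
      bump_nonneg[of r x y] bump_nonneg[of r x' y] assms(1) by simp
qed

lemma weighted_integral_bound:
  fixes w :: "'a \<Rightarrow> real"
  assumes [measurable]: "B \<in> sets \<nu>" "h \<in> borel_measurable \<nu>"
    and w: "set_integrable \<nu> B w" and h: "\<And>y. \<bar>h y\<bar> \<le> b * indicator B y"
  shows "integrable \<nu> (\<lambda>y. h y * w y)"
    and "\<bar>LINT y|\<nu>. h y * w y\<bar> \<le> b * (LINT y:B|\<nu>. \<bar>w y\<bar>)"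
proof -
  have wB: "integrable \<nu> (\<lambda>y. indicator B y * w y)"
    using w by (simp add: set_integrable_def)
  have eq: "h y * w y = h y * (indicator B y * w y)" for y
    using h[of y] by (auto simp: indicator_def)
  have pt: "\<bar>h y * w y\<bar> \<le> b * (indicator B y * \<bar>w y\<bar>)" for y
    using mult_right_mono[OF h[of y], of "\<bar>w y\<bar>"] by (simp add: abs_mult mult.assoc)
  have abs: "integrable \<nu> (\<lambda>y. b * (indicator B y * \<bar>w y\<bar>))"
    using integrable_abs[OF wB] by (simp add: abs_mult)
  have "(\<lambda>y. h y * (indicator B y * w y)) \<in> borel_measurable \<nu>"
    using borel_measurable_integrable[OF wB] by measurable
  then have meas: "(\<lambda>y. h y * w y) \<in> borel_measurable \<nu>"
    by (simp flip: eq)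
  show int: "integrable \<nu> (\<lambda>y. h y * w y)"
    by (rule Bochner_Integration.integrable_bound[OF abs meas])
      (use pt abs_ge_self order.trans in \<open>fastforce intro!: AE_I2\<close>)
  have "\<bar>LINT y|\<nu>. h y * w y\<bar> \<le> (LINT y|\<nu>. \<bar>h y * w y\<bar>)"
    by (rule integral_abs_bound)
  also have "\<dots> \<le> (LINT y|\<nu>. b * (indicator B y * \<bar>w y\<bar>))"
    by (rule integral_mono[OF integrable_abs[OF int] abs pt])
  finally show "\<bar>LINT y|\<nu>. h y * w y\<bar> \<le> b * (LINT y:B|\<nu>. \<bar>w y\<bar>)"
    by (simp add: set_lebesgue_integral_def)
qed

lemma set_integrable_ball_diff:
  fixes u :: "'a \<Rightarrow> real"
  assumes "integrable \<nu> u"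
  shows "set_integrable \<nu> (ball x r) (\<lambda>y. u y - a)"
proof -
  have "set_integrable \<nu> (ball x r) u"
    unfolding set_integrable_def real_scaleR_def
    using integrable_mult_indicator[of "ball x r" \<nu> u] assms by (simp add: sets_eq)
  moreover have "set_integrable \<nu> (ball x r) (\<lambda>y. a)"
    unfolding set_integrable_def using ball_finite[of x r]
    by (simp add: sets_eq)
  ultimately show ?thesis by (rule set_integral_diff)
qed

text \<open>Dropping from \<open>r\<close> to the radius \<open>r / 4\<close>, on which the bump is at least \<open>1 / 2\<close>, and moving the
  centre costs three doublings.\<close>

definition bump_const :: real where
  "bump_const = 2 * C ^ 3"

lemma bump_const_ge_1: "1 \<le> bump_const"
  using one_le_power[OF C_ge_1, of 3] by (simp add: bump_const_def)

lemma bump_integrable: "0 < r \<Longrightarrow> integrable \<nu> (bump r x)"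
proof (rule Bochner_Integration.integrable_bound[of \<nu> "indicator (ball x r) :: 'a \<Rightarrow> real"])
  assume "0 < r"
  show "integrable \<nu> (indicator (ball x r) :: 'a \<Rightarrow> real)"
    using ball_finite[of x r] by (simp add: sets_eq)
  show "AE y in \<nu>. norm (bump r x y) \<le> norm (indicator (ball x r) y :: real)"
    using bump_le_indicator[OF \<open>0 < r\<close>, of x x] bump_nonneg[of r x] \<open>0 < r\<close> by simp
qed simp

lemma bump_mass_ge:
  assumes r: "0 < r" and x: "dist x x' < r / 2"
  shows "vol r x / bump_const \<le> (LINT y|\<nu>. bump r x' y)"
proof -
  have "vol r x \<le> C ^ 3 * vol (r / 4) x'"
    using x r by (intro vol_compare) (auto simp: dist_commute)
  then have "vol r x / bump_const \<le> 1 / 2 * vol (r / 4) x'"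
    using C_ge_1 by (simp add: bump_const_def field_simps)
  also have "\<dots> = (LINT y|\<nu>. 1 / 2 * indicator (ball x' (r / 4)) y)"
    by (simp add: sets_eq)
  also have "\<dots> \<le> (LINT y|\<nu>. bump r x' y)"
  proof (rule integral_mono)
    show "integrable \<nu> (\<lambda>y. 1 / 2 * indicator (ball x' (r / 4)) y :: real)"
      using ball_finite[of x' "r / 4"] by (simp add: sets_eq)
    show "1 / 2 * indicator (ball x' (r / 4)) y \<le> bump r x' y" for y
      using r by (auto simp: bump_def indicator_def field_simps)
  qed (rule bump_integrable[OF r])
  finally show ?thesis .
qed

lemma bump_mass_pos: "0 < r \<Longrightarrow> 0 < (LINT y|\<nu>. bump r x y)"
  using bump_mass_ge[of r x x] vol_pos[of r x] bump_const_ge_1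
  by (smt (verit) divide_pos_pos dist_self half_gt_zero)

lemma smooth_minus_const:
  assumes u: "integrable \<nu> u" and r: "0 < r"
  shows "smooth r u x - a = (LINT y|\<nu>. bump r x y * (u y - a)) / (LINT y|\<nu>. bump r x y)"
proof -
  have "integrable \<nu> (\<lambda>y. bump r x y * u y)"
    using set_integrable_ball_diff[OF u, of x r 0] bump_le_indicator[OF r, of x x] bump_nonneg[of r x] r
    by (intro weighted_integral_bound(1)[of "ball x r" _ _ 1]) (auto simp: sets_eq)
  then have "(LINT y|\<nu>. bump r x y * (u y - a))
      = (LINT y|\<nu>. bump r x y * u y) - (LINT y|\<nu>. bump r x y) * a"
    using bump_integrable[OF r, of x] by (simp add: right_diff_distrib)
  then show ?thesis
    using bump_mass_pos[OF r, of x] by (simp add: smooth_def diff_divide_distrib)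
qed

lemma smooth_close:
  assumes u: "integrable \<nu> u" and r: "0 < r"
  shows "\<bar>smooth r u x - a\<bar> \<le> bump_const * ((LINT y:ball x r|\<nu>. \<bar>u y - a\<bar>) / vol r x)"
proof -
  define I where "I = (LINT y:ball x r|\<nu>. \<bar>u y - a\<bar>)"
  define N where "N = (LINT y|\<nu>. bump r x y)"
  have N: "0 < N" "vol r x / bump_const \<le> N"
    using bump_mass_pos[OF r] bump_mass_ge[OF r, of x x] r by (auto simp: N_def)
  have I: "\<bar>LINT y|\<nu>. bump r x y * (u y - a)\<bar> \<le> 1 * I"
    unfolding I_def
    using set_integrable_ball_diff[OF u] bump_le_indicator[OF r, of x x] bump_nonneg[of r x] r
    by (intro weighted_integral_bound(2)) (auto simp: sets_eq)
  have "\<bar>smooth r u x - a\<bar> \<le> I / N"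
    unfolding smooth_minus_const[OF u r] using I N by (simp add: N_def[symmetric] divide_right_mono)
  also have "\<dots> \<le> I / (vol r x / bump_const)"
    using N I vol_pos[OF r, of x] bump_const_ge_1 by (intro divide_left_mono) auto
  finally show ?thesis by (simp add: I_def mult.commute)
qed

text \<open>With \<open>N, N'\<close> the masses of the two bumps and \<open>P, P'\<close> the integrals of \<open>u - a\<close> against them,
  \<open>P'/N' - P/N = (P' - P)/N' + P (N - N')/(N N')\<close>, and each summand carries one factor from the
  Lipschitz bound for the bump.  The constant \<open>a\<close> is free: \<open>a = u x\<close> yields the bound on the slope,
  \<open>a = 0\<close> a Lipschitz constant that is uniform near each point.\<close>

lemma smooth_difference:
  assumes u: "integrable \<nu> u" and r: "0 < r" and x: "dist x x' < r / 2"
  shows "\<bar>smooth r u x' - smooth r u x\<bar>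
    \<le> 4 * bump_const ^ 2 / r * ((LINT y:ball x r|\<nu>. \<bar>u y - a\<bar>) / vol r x) * dist x x'"
proof -
  define k where "k = bump_const"
  define V where "V = vol r x"
  define I where "I = (LINT y:ball x r|\<nu>. \<bar>u y - a\<bar>)"
  define \<delta> where "\<delta> = 2 / r * dist x x'"
  define N where "N = (LINT y|\<nu>. bump r x y)"
  define N' where "N' = (LINT y|\<nu>. bump r x' y)"
  define P where "P = (LINT y|\<nu>. bump r x y * (u y - a))"
  define P' where "P' = (LINT y|\<nu>. bump r x' y * (u y - a))"
  have x0: "dist x x < r / 2" using r by simp
  have k: "1 \<le> k" and V: "0 < V" and \<delta>: "0 \<le> \<delta>"
    using bump_const_ge_1 vol_pos[OF r] r by (auto simp: k_def V_def \<delta>_def)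
  have N: "0 < N" "V / k \<le> N" and N': "0 < N'" "V / k \<le> N'"
    using bump_mass_pos[OF r] bump_mass_ge[OF r x] bump_mass_ge[OF r x0]
    by (auto simp: N_def N'_def V_def k_def)
  have ball: "ball x r \<in> sets \<nu>" by (simp add: sets_eq)
  note w = set_integrable_ball_diff[OF u, of x r a]
  have abs_bump: "\<bar>bump r z y\<bar> \<le> 1 * indicator (ball x r) y" if "dist x z < r / 2" for z y
    using bump_le_indicator[OF r that, of y] bump_nonneg[of r z y] by simp
  have int: "integrable \<nu> (\<lambda>y. bump r z y * (u y - a))" if "dist x z < r / 2" for z
    using weighted_integral_bound(1)[OF ball bump_measurable w abs_bump] that by blast
  have P: "\<bar>P\<bar> \<le> I"
    using weighted_integral_bound(2)[OF ball bump_measurable w abs_bump[OF x0]] by (simp add: P_def I_def)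
  have "P' - P = (LINT y|\<nu>. (bump r x' y - bump r x y) * (u y - a))"
    unfolding P_def P'_def using int[OF x] int[OF x0] by (simp add: left_diff_distrib)
  also have "\<bar>\<dots>\<bar> \<le> \<delta> * I"
    unfolding I_def \<delta>_def
    by (intro weighted_integral_bound(2)[OF ball _ w] bump_lipschitz r x) measurable
  finally have PP: "\<bar>P' - P\<bar> \<le> \<delta> * I" .
  have "N' - N = (LINT y|\<nu>. bump r x' y - bump r x y)"
    unfolding N_def N'_def using bump_integrable[OF r] by simp
  also have "\<bar>\<dots>\<bar> \<le> (LINT y|\<nu>. \<bar>bump r x' y - bump r x y\<bar>)"
    by (rule integral_abs_bound)
  also have "\<dots> \<le> (LINT y|\<nu>. \<delta> * indicator (ball x r) y)"
    unfolding \<delta>_def using bump_integrable[OF r] ball_finite[of x r] bump_lipschitz[OF r x]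
    by (intro integral_mono integrable_abs Bochner_Integration.integrable_diff) (auto simp: sets_eq)
  also have "\<dots> = \<delta> * V" by (simp add: V_def sets_eq)
  finally have NN: "\<bar>N' - N\<bar> \<le> \<delta> * V" .
  have I: "0 \<le> I" using P by linarith
  have inv: "1 / N \<le> k / V" "1 / N' \<le> k / V"
    using N N' V k by (simp_all add: field_simps)
  have "smooth r u x' - smooth r u x = P' / N' - P / N"
    using smooth_minus_const[OF u r, of x' a] smooth_minus_const[OF u r, of x a]
    by (simp add: P_def P'_def N_def N'_def)
  also have "\<dots> = (P' - P) * (1 / N') + P * ((N - N') * (1 / N)) * (1 / N')"
    using N(1) N'(1) by (simp add: field_simps)
  also have "\<bar>\<dots>\<bar> \<le> \<bar>P' - P\<bar> * (1 / N') + \<bar>P\<bar> * (\<bar>N' - N\<bar> * (1 / N)) * (1 / N')"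
    using N(1) N'(1) by (intro order.trans[OF abs_triangle_ineq]) (simp add: abs_mult abs_minus_commute)
  also have "\<dots> \<le> \<delta> * I * (k / V) + I * (\<delta> * V * (k / V)) * (k / V)"
    using N(1) N'(1) V k I \<delta> PP NN P inv by (intro add_mono mult_mono) auto
  also have "\<dots> = \<delta> * I / V * (k + k * k)" using V by (simp add: field_simps)
  also have "\<dots> \<le> \<delta> * I / V * (2 * k ^ 2)"
    using \<delta> I V k by (intro mult_left_mono) (auto simp: power2_eq_square)
  finally show ?thesis by (simp add: k_def V_def I_def \<delta>_def mult_ac)
qed

lemma osc_eq_integral:
  assumes u: "integrable \<nu> u" and r: "0 < r"
  shows "osc r u x = ennreal ((LINT y:ball x r|\<nu>. \<bar>u y - u x\<bar>) / vol r x)"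
proof -
  have "integrable \<nu> (\<lambda>y. indicator (ball x r) y * (u y - u x))"
    using set_integrable_ball_diff[OF u, of x r "u x"] by (simp add: set_integrable_def)
  from integrable_abs[OF this]
  have "(\<integral>\<^sup>+y. ennreal (indicator (ball x r) y * \<bar>u y - u x\<bar>) \<partial>\<nu>)
      = ennreal (LINT y:ball x r|\<nu>. \<bar>u y - u x\<bar>)"
    unfolding set_lebesgue_integral_def real_scaleR_def
    by (intro nn_integral_eq_integral) (auto simp: abs_mult)
  moreover have "(\<integral>\<^sup>+y\<in>ball x r. ennreal \<bar>u y - u x\<bar> \<partial>\<nu>)
      = (\<integral>\<^sup>+y. ennreal (indicator (ball x r) y * \<bar>u y - u x\<bar>) \<partial>\<nu>)"
    by (intro nn_integral_cong) (auto simp: indicator_def)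
  ultimately show ?thesis
    unfolding osc_def using vol_pos[OF r, of x] by (simp flip: ennreal_mult')
qed

lemma slope_smooth_le:
  assumes u: "integrable \<nu> u" and r: "0 < r"
  shows "slope (smooth r u) x \<le> ennreal (4 * bump_const ^ 2 / r) * osc r u x"
proof -
  have "slope (smooth r u) x
      \<le> ennreal (4 * bump_const ^ 2 / r * ((LINT y:ball x r|\<nu>. \<bar>u y - u x\<bar>) / vol r x))"
    using smooth_difference[OF u r] r by (intro slope_le[of "r / 2"]) auto
  also have "\<dots> = ennreal (4 * bump_const ^ 2 / r) * osc r u x"
    using r by (simp add: osc_eq_integral[OF u r] flip: ennreal_mult')
  finally show ?thesis .
qed

lemma smooth_close_osc:
  assumes u: "integrable \<nu> u" and r: "0 < r"
  shows "ennreal \<bar>smooth r u x - u x\<bar> \<le> ennreal bump_const * osc r u x"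
  using smooth_close[OF u r, of x "u x"] bump_const_ge_1
  by (simp add: osc_eq_integral[OF u r] ennreal_leI flip: ennreal_mult')

lemma locally_lipschitz_smooth:
  assumes u: "integrable \<nu> u" and r: "0 < r"
  shows "locally_lipschitz (smooth r u)"
  unfolding locally_lipschitz_def
proof
  fix x0
  define M where "M = (LINT y|\<nu>. \<bar>u y\<bar>)"
  define L where "L = 4 * bump_const ^ 2 / r * (M / vol (r / 2) x0)"
  have M: "0 \<le> M" by (simp add: M_def)
  have V0: "0 < vol (r / 2) x0" using r by (intro vol_pos) simp
  have "L-lipschitz_on (ball x0 (r / 4)) (smooth r u)"
  proof (rule lipschitz_onI)
    show "0 \<le> L" using M V0 r by (simp add: L_def)
    fix x x' assume x: "x \<in> ball x0 (r / 4)" "x' \<in> ball x0 (r / 4)"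
    have "dist x x' < r / 2" using x dist_triangle[of x x' x0] by (simp add: dist_commute)
    from smooth_difference[OF u r this, of 0]
    have "\<bar>smooth r u x' - smooth r u x\<bar>
        \<le> 4 * bump_const ^ 2 / r * ((LINT y:ball x r|\<nu>. \<bar>u y\<bar>) / vol r x) * dist x x'" by simp
    also have "\<dots> \<le> L * dist x x'"
    proof -
      have "vol (r / 2) x0 \<le> vol r x"
      proof (rule vol_mono)
        show "ball x0 (r / 2) \<subseteq> ball x r"
        proof
          fix y assume "y \<in> ball x0 (r / 2)"
          then show "y \<in> ball x r" using x dist_triangle[of x y x0] r by (simp add: dist_commute)
        qed
      qed
      moreover have "(LINT y:ball x r|\<nu>. \<bar>u y\<bar>) \<le> M"
        unfolding M_def set_lebesgue_integral_def
        using integrable_mult_indicator[of "ball x r" \<nu> "\<lambda>y. \<bar>u y\<bar>"] u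
        by (intro integral_mono) (auto simp: sets_eq indicator_def)
      ultimately have "(LINT y:ball x r|\<nu>. \<bar>u y\<bar>) / vol r x \<le> M / vol (r / 2) x0"
        using V0 M by (intro frac_le) auto
      then show ?thesis unfolding L_def using r by (intro mult_right_mono mult_left_mono) auto
    qed
    finally show "dist (smooth r u x) (smooth r u x') \<le> L * dist x x'"
      by (simp add: dist_real_def abs_minus_commute)
  qed
  then show "\<exists>s>0. \<exists>L. L-lipschitz_on (ball x0 s) (smooth r u)"
    using r by (intro exI[of _ "r / 4"]) auto
qed

lemma smooth_estimates:
  assumes u: "integrable \<nu> u" and r: "0 < r"
  shows "(\<integral>\<^sup>+x. slope (smooth r u) x \<partial>\<nu>) \<le> ennreal (4 * bump_const ^ 2 / r) * energy r u"
    and "(\<integral>\<^sup>+x. ennreal \<bar>smooth r u x - u x\<bar> \<partial>\<nu>) \<le> ennreal bump_const * energy r u"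
proof -
  have [measurable]: "u \<in> borel_measurable \<nu>" using u by (rule borel_measurable_integrable)
  have "(\<integral>\<^sup>+x. slope (smooth r u) x \<partial>\<nu>) \<le> (\<integral>\<^sup>+x. ennreal (4 * bump_const ^ 2 / r) * osc r u x \<partial>\<nu>)"
    by (intro nn_integral_mono slope_smooth_le u r)
  then show "(\<integral>\<^sup>+x. slope (smooth r u) x \<partial>\<nu>) \<le> ennreal (4 * bump_const ^ 2 / r) * energy r u"
    by (simp add: nn_integral_cmult energy_def)
  have "(\<integral>\<^sup>+x. ennreal \<bar>smooth r u x - u x\<bar> \<partial>\<nu>) \<le> (\<integral>\<^sup>+x. ennreal bump_const * osc r u x \<partial>\<nu>)"
    by (intro nn_integral_mono smooth_close_osc u r)
  then show "(\<integral>\<^sup>+x. ennreal \<bar>smooth r u x - u x\<bar> \<partial>\<nu>) \<le> ennreal bump_const * energy r u"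
    by (simp add: nn_integral_cmult energy_def)
qed

text \<open>Scales \<open>r \<rightarrow> 0\<close> along which the rescaled walk variation stays below \<open>b\<close> turn into smoothings of
  bounded slope; they converge in \<open>L\<^sup>1\<close> because the unscaled energies \<open>\<le> 2 r b\<close> vanish.\<close>

lemma approximation_of_walk_TV:
  assumes u: "integrable \<nu> u" and b: "b < \<infinity>"
    and less: "Liminf (at_right 0) (\<lambda>\<epsilon>. ennreal (1 / \<epsilon>) * walk_TV \<nu> (step_walk \<nu> \<epsilon>) u) < b"
  obtains v where "loc_lip_approx \<nu> v u"
    "\<And>n. (\<integral>\<^sup>+x. slope (v n) x \<partial>\<nu>) \<le> ennreal (8 * bump_const ^ 2) * b"
proof -
  define F where "F = (\<lambda>\<epsilon>. ennreal (1 / \<epsilon>) * walk_TV \<nu> (step_walk \<nu> \<epsilon>) u)"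
  have u_meas: "u \<in> borel_measurable \<nu>" using u by (rule borel_measurable_integrable)
  have "\<exists>r. 0 < r \<and> r < 1 / real (Suc n) \<and> F r < b" for n
  proof (rule ccontr)
    assume none: "\<not> ?thesis"
    have "0 < 1 / real (Suc n)" by simp
    then have "\<forall>\<^sub>F r in at_right 0. b \<le> F r"
      unfolding eventually_at_right_field using none not_less by blast
    then have "b \<le> Liminf (at_right 0) F" by (rule Liminf_bounded)
    then show False using less by (simp add: F_def)
  qed
  then obtain \<rho> where \<rho>: "\<And>n. 0 < \<rho> n" "\<And>n. \<rho> n < 1 / real (Suc n)" "\<And>n. F (\<rho> n) < b"
    by metis
  obtain b' where b': "b = ennreal b'" "0 \<le> b'"
    using b by (cases b) auto
  define v where "v = (\<lambda>n. smooth (\<rho> n) u)"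
  have energy: "energy (\<rho> n) u \<le> ennreal (2 * \<rho> n) * b" for n
  proof -
    have "ennreal (2 * \<rho> n) * ennreal (1 / (2 * \<rho> n)) = 1"
      using \<rho>(1)[of n] by (simp flip: ennreal_mult')
    then have "energy (\<rho> n) u = ennreal (2 * \<rho> n) * F (\<rho> n)"
      by (simp add: F_def walk_TV_eq_energy[OF u_meas \<rho>(1)] mult.assoc[symmetric])
    also have "\<dots> \<le> ennreal (2 * \<rho> n) * b"
      using \<rho>(3)[of n] by (intro mult_left_mono) auto
    finally show ?thesis .
  qed
  have slope: "(\<integral>\<^sup>+x. slope (v n) x \<partial>\<nu>) \<le> ennreal (8 * bump_const ^ 2) * b" for n
  proof -
    have "(\<integral>\<^sup>+x. slope (v n) x \<partial>\<nu>) \<le> ennreal (4 * bump_const ^ 2 / \<rho> n) * energy (\<rho> n) u"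
      unfolding v_def by (rule smooth_estimates(1)[OF u \<rho>(1)])
    also have "\<dots> \<le> ennreal (4 * bump_const ^ 2 / \<rho> n) * (ennreal (2 * \<rho> n) * b)"
      by (intro mult_left_mono energy) simp
    also have "\<dots> = ennreal (8 * bump_const ^ 2) * b"
      using \<rho>(1)[of n] by (simp add: mult.assoc[symmetric] flip: ennreal_mult')
    finally show ?thesis .
  qed
  have lip: "locally_lipschitz (v n)" for n
    unfolding v_def by (rule locally_lipschitz_smooth[OF u \<rho>(1)])
  have dist: "(\<integral>\<^sup>+x. ennreal \<bar>v n x - u x\<bar> \<partial>\<nu>) \<le> ennreal (bump_const * (2 * \<rho> n * b'))" for n
  proof -
    have "(\<integral>\<^sup>+x. ennreal \<bar>v n x - u x\<bar> \<partial>\<nu>) \<le> ennreal bump_const * energy (\<rho> n) u"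
      unfolding v_def by (rule smooth_estimates(2)[OF u \<rho>(1)])
    also have "\<dots> \<le> ennreal bump_const * (ennreal (2 * \<rho> n) * ennreal b')"
      using energy by (intro mult_left_mono) (auto simp: b')
    also have "\<dots> = ennreal (bump_const * (2 * \<rho> n * b'))"
      using \<rho>(1)[of n] bump_const_ge_1 b' by (simp flip: ennreal_mult')
    finally show ?thesis .
  qed
  have v_meas: "v n \<in> borel_measurable \<nu>" for n
    using borel_measurable_continuous_onI[OF locally_lipschitz_continuous[OF lip]]
      measurable_cong_sets[OF sets_eq refl] by blast
  have int_diff: "integrable \<nu> (\<lambda>x. v n x - u x)" for n
    using dist[of n] v_meas u_meas
    by (intro integrableI_bounded) (auto intro: order.strict_trans1)
  have int_v: "integrable \<nu> (v n)" for n
    using Bochner_Integration.integrable_add[OF int_diff u, of n] by simp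
  have le: "(LINT x|\<nu>. \<bar>v n x - u x\<bar>) \<le> bump_const * (2 * \<rho> n * b')" for n
    using dist[of n] nn_integral_eq_integral[OF integrable_abs[OF int_diff[of n]]]
      \<rho>(1)[of n] b' bump_const_ge_1 by simp
  have lim: "(\<lambda>n. bump_const * (2 * \<rho> n * b')) \<longlonglongrightarrow> bump_const * (2 * 0 * b')"
  proof (intro tendsto_mult tendsto_const)
    show "\<rho> \<longlonglongrightarrow> 0"
    proof (rule tendsto_sandwich[where f = "\<lambda>_. 0" and h = "\<lambda>n. 1 / real (Suc n)"])
      show "(\<lambda>n. 1 / real (Suc n)) \<longlonglongrightarrow> 0" by (rule LIMSEQ_Suc[OF lim_1_over_n])
      show "\<forall>\<^sub>F n in sequentially. \<rho> n \<le> 1 / real (Suc n)"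
        by (intro always_eventually allI less_imp_le \<rho>(2))
      show "\<forall>\<^sub>F n in sequentially. 0 \<le> \<rho> n"
        by (intro always_eventually allI less_imp_le \<rho>(1))
    qed (rule tendsto_const)
  qed
  have "(\<lambda>n. LINT x|\<nu>. \<bar>v n x - u x\<bar>) \<longlonglongrightarrow> 0"
  proof (rule tendsto_sandwich[where f = "\<lambda>_. 0" and h = "\<lambda>n. bump_const * (2 * \<rho> n * b')"])
    show "(\<lambda>n. bump_const * (2 * \<rho> n * b')) \<longlonglongrightarrow> 0"
      using lim by (simp only: mult_zero_left mult_zero_right)
    show "\<forall>\<^sub>F n in sequentially. (LINT x|\<nu>. \<bar>v n x - u x\<bar>) \<le> bump_const * (2 * \<rho> n * b')"
      by (intro always_eventually allI le)
  qed simp_all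
  then have "loc_lip_approx \<nu> v u"
    using lip int_v by (simp add: loc_lip_approx_def)
  then show ?thesis using slope that by blast
qed

end

section \<open>Comparison of the two variations\<close>

lemma ennreal_divide_le:
  assumes "0 < k" "a \<le> ennreal k * b"
  shows "ennreal (1 / k) * a \<le> b"
proof -
  have "ennreal (1 / k) * a \<le> ennreal (1 / k) * (ennreal k * b)"
    by (rule mult_left_mono[OF assms(2)]) simp
  also have "\<dots> = b"
    using assms(1) by (simp add: mult.assoc[symmetric] flip: ennreal_mult')
  finally show ?thesis .
qed

lemma total_variation_finite:
  assumes "u \<in> BV \<nu>"
  shows "total_variation \<nu> u < \<infinity>"
proof -
  obtain v where v: "loc_lip_approx \<nu> v u" "(SUP n. \<integral>\<^sup>+x. slope (v n) x \<partial>\<nu>) < \<infinity>"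
    using assms by (auto simp: BV_def)
  have "total_variation \<nu> u \<le> liminf (\<lambda>n. \<integral>\<^sup>+x. slope (v n) x \<partial>\<nu>)"
    unfolding total_variation_def using v(1) by (intro Inf_lower) auto
  also have "\<dots> \<le> (SUP n. \<integral>\<^sup>+x. slope (v n) x \<partial>\<nu>)"
    by (intro Liminf_le always_eventually allI SUP_upper) auto
  finally show ?thesis using v(2) by (rule order.strict_trans1)
qed

theorem theorem2p22:
  fixes \<nu> :: "'a::polish_space measure"
  assumes "sets \<nu> = sets borel"
    and "doubling \<nu>"
    and "supports_poincare_1 \<nu>"
  shows "(\<forall>u. integrable \<nu> u \<longrightarrow>
            (u \<in> BV \<nu> \<longleftrightarrow>
             Liminf (at_right 0) (\<lambda>\<epsilon>. ennreal (1 / \<epsilon>) * walk_TV \<nu> (step_walk \<nu> \<epsilon>) u) < \<infinity>)) \<and>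
         (\<exists>C\<ge>1::real. \<forall>u\<in>BV \<nu>.
            ennreal (1 / C) * total_variation \<nu> u
              \<le> Liminf (at_right 0) (\<lambda>\<epsilon>. ennreal (1 / \<epsilon>) * walk_TV \<nu> (step_walk \<nu> \<epsilon>) u) \<and>
            Liminf (at_right 0) (\<lambda>\<epsilon>. ennreal (1 / \<epsilon>) * walk_TV \<nu> (step_walk \<nu> \<epsilon>) u)
              \<le> ennreal C * total_variation \<nu> u)"
proof -
  obtain D where D: "1 \<le> D" and pos: "\<And>x r. 0 < r \<Longrightarrow> 0 < emeasure \<nu> (ball x (2 * r))"
    and double: "\<And>x r. 0 < r \<Longrightarrow> emeasure \<nu> (ball x (2 * r)) \<le> ennreal D * emeasure \<nu> (ball x r)"
    and fin: "\<And>x r. 0 < r \<Longrightarrow> ennreal D * emeasure \<nu> (ball x r) < \<infinity>"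
    using assms(2) unfolding doubling_def by metis
  obtain c \<Lambda> where c: "0 < c" "1 \<le> \<Lambda>"
    and poincare: "\<And>u L x r. L-lipschitz_on UNIV u \<Longrightarrow> 0 < r \<Longrightarrow>
      (\<integral>\<^sup>+y\<in>ball x r. ennreal \<bar>u y - ball_avg \<nu> u x r\<bar> \<partial>\<nu>)
        \<le> ennreal (c * r) * (\<integral>\<^sup>+y\<in>ball x (\<Lambda> * r). slope u y \<partial>\<nu>)"
    using assms(3) unfolding supports_poincare_1_def by blast
  have finite: "emeasure \<nu> (ball x r) < \<infinity>" for x r
  proof (cases "0 < r")
    case True
    then show ?thesis using fin[of r x] D by (auto simp: ennreal_mult_less_top)
  qed (simp add: ball_empty)
  interpret poincare_space \<nu> D c \<Lambda>
  proof
    show "0 < emeasure \<nu> (ball x r)" if "0 < r" for x r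
      using pos[of "r / 2" x] that by simp
    show "measure \<nu> (ball x (2 * r)) \<le> D * measure \<nu> (ball x r)" if "0 < r" for x r
      using double[OF that, of x] finite D
      by (simp add: emeasure_eq_ennreal_measure less_top[symmetric] flip: ennreal_mult')
  qed (fact assms(1) D finite c poincare)+
  define F where "F = (\<lambda>u. Liminf (at_right 0) (\<lambda>\<epsilon>. ennreal (1 / \<epsilon>) * walk_TV \<nu> (step_walk \<nu> \<epsilon>) u))"
  define A where "A = 8 * bump_const ^ 2"
  have A: "1 \<le> A" using one_le_power[OF bump_const_ge_1, of 2] by (simp add: A_def)
  have lower: "ennreal (1 / A) * total_variation \<nu> u \<le> F u" if u: "integrable \<nu> u" for u
  proof (rule dense_ge)
    fix b assume b: "F u < b"
    show "ennreal (1 / A) * total_variation \<nu> u \<le> b"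
    proof (cases "b < \<infinity>")
      case True
      obtain v where v: "loc_lip_approx \<nu> v u" "\<And>n. (\<integral>\<^sup>+x. slope (v n) x \<partial>\<nu>) \<le> ennreal A * b"
        using approximation_of_walk_TV[OF u True] b by (auto simp: F_def A_def)
      have "total_variation \<nu> u \<le> liminf (\<lambda>n. \<integral>\<^sup>+x. slope (v n) x \<partial>\<nu>)"
        unfolding total_variation_def using v(1) by (intro Inf_lower) auto
      also have "\<dots> \<le> ennreal A * b"
        by (intro Liminf_le always_eventually allI v) simp
      finally show ?thesis using A by (intro ennreal_divide_le) auto
    qed (simp add: not_less top_unique)
  qed
  obtain j where j: "2 * \<Lambda> \<le> 2 ^ j"
    using real_arch_pow[of 2 "2 * \<Lambda>"] by (auto intro: less_imp_le)
  define K where "K = 4 * c * D ^ (4 + j)"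
  have K: "0 < K" using c D by (simp add: K_def)
  have upper: "F u \<le> ennreal (K / 2) * total_variation \<nu> u" if u: "integrable \<nu> u" for u
    unfolding F_def
  proof (rule Liminf_le)
    have u_meas: "u \<in> borel_measurable \<nu>" using u by (rule borel_measurable_integrable)
    show "\<forall>\<^sub>F \<epsilon> in at_right 0. ennreal (1 / \<epsilon>) * walk_TV \<nu> (step_walk \<nu> \<epsilon>) u
        \<le> ennreal (K / 2) * total_variation \<nu> u"
      using eventually_at_right_less[of 0]
    proof eventually_elim
      case (elim r)
      have "ennreal (1 / (K * r)) * energy r u \<le> total_variation \<nu> u"
        unfolding total_variation_def
        using energy_le_liminf_slope[OF u _ elim j] by (intro Inf_greatest) (auto simp: K_def)
      then have "ennreal (K / 2) * (ennreal (1 / (K * r)) * energy r u)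
          \<le> ennreal (K / 2) * total_variation \<nu> u"
        by (rule mult_left_mono) simp
      moreover have "ennreal (K / 2) * ennreal (1 / (K * r)) = ennreal (1 / (2 * r))"
        using K elim by (simp add: field_simps flip: ennreal_mult')
      ultimately show ?case
        by (simp add: walk_TV_eq_energy[OF u_meas elim] mult.assoc[symmetric])
    qed
  qed simp
  have "u \<in> BV \<nu> \<longleftrightarrow> F u < \<infinity>" if u: "integrable \<nu> u" for u
  proof
    assume "u \<in> BV \<nu>"
    then have "ennreal (K / 2) * total_variation \<nu> u < \<infinity>"
      using total_variation_finite by (auto simp: ennreal_mult_less_top)
    then show "F u < \<infinity>" using upper[OF u] by (rule order.strict_trans1[rotated])
  next
    assume "F u < \<infinity>"
    then obtain b where b: "F u < b" "b < \<infinity>" using dense by blast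
    obtain v where v: "loc_lip_approx \<nu> v u" "\<And>n. (\<integral>\<^sup>+x. slope (v n) x \<partial>\<nu>) \<le> ennreal A * b"
      using approximation_of_walk_TV[OF u b(2)] b(1) by (auto simp: F_def A_def)
    have "(SUP n. \<integral>\<^sup>+x. slope (v n) x \<partial>\<nu>) \<le> ennreal A * b"
      by (intro SUP_least v)
    also have "\<dots> < \<infinity>" using b by (simp add: ennreal_mult_less_top)
    finally show "u \<in> BV \<nu>" using u v(1) by (auto simp: BV_def)
  qed
  moreover have "\<exists>C\<ge>1::real. \<forall>u\<in>BV \<nu>. ennreal (1 / C) * total_variation \<nu> u \<le> F u
      \<and> F u \<le> ennreal C * total_variation \<nu> u"
  proof (intro exI[of _ "max A (K / 2)"] conjI ballI)
    show "1 \<le> max A (K / 2)" using A by simp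
    fix u assume "u \<in> BV \<nu>"
    then have u: "integrable \<nu> u" by (simp add: BV_def)
    have "ennreal (1 / max A (K / 2)) * total_variation \<nu> u \<le> ennreal (1 / A) * total_variation \<nu> u"
      using A by (intro mult_right_mono ennreal_leI divide_left_mono) auto
    then show "ennreal (1 / max A (K / 2)) * total_variation \<nu> u \<le> F u"
      using lower[OF u] by (rule order.trans)
    have "ennreal (K / 2) * total_variation \<nu> u \<le> ennreal (max A (K / 2)) * total_variation \<nu> u"
      by (intro mult_right_mono ennreal_leI) auto
    then show "F u \<le> ennreal (max A (K / 2)) * total_variation \<nu> u"
      using upper[OF u] by (rule order.trans[rotated])
  qed
  ultimately show ?thesis unfolding F_def by blast
qed

end
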